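(* (1) Let $\mathcal C,\mathcal D$ be finite categories, let $\Omega$ be a $(\mathcal C,\mathcal D)$-biset and let $\mathcal E=\mathrm{Cograph}(\Omega)$. Then $\mathcal E$ has $\mathcal C$ and $\mathcal D$ as full subcategories, and $\Omega={}_{\mathcal C^F}\mathcal E_{{}^G\mathcal D}$ as a $(\mathcal C,\mathcal D)$-biset, where $F:\mathcal C\to\mathcal E$ and $G:\mathcal D\to\mathcal E$ are the inclusion functors. (2) Let $\mathcal E$ be a finite category with full subcategories $\mathcal C,\mathcal D$ whose objects partition the objects of $\mathcal E$ as $\mathrm{Ob}\,\mathcal E=\mathrm{Ob}\,\mathcal C\sqcup\mathrm{Ob}\,\mathcal D$. Suppose that there are no morphisms $x\to y$ with $x\in\mathcal C$ and $y\in\mathcal D$. Then $\mathcal E=\mathrm{Cograph}({}_{\mathcal C}\mathcal E_{\mathcal D})$ as categories.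
   Context: $\mathrm{Set}$ is the category of finite sets. A $(\mathcal C,\mathcal D)$-biset is a functor $\Omega:\mathcal C\times\mathcal D^{\mathrm{op}}\to\mathrm{Set}$. For functors $F:\mathcal C\to\mathcal E$ and $G:\mathcal D\to\mathcal E$, the $(\mathcal C,\mathcal D)$-biset ${}_{\mathcal C^F}\mathcal E_{{}^G\mathcal D}$ is defined by $(x,y)\mapsto\mathrm{Hom}_{\mathcal E}(G(y),F(x))$, with morphisms of $\mathcal C$ and $\mathcal D$ acting by composition in $\mathcal E$ after applying $F$ and $G$. When $F$ and $G$ are inclusions of subcategories they are omitted from the notation: ${}_{\mathcal C}\mathcal E_{\mathcal D}$. For a $(\mathcal C,\mathcal D)$-biset $\Omega$, the category $\mathrm{Cograph}(\Omega)$ has objects $\mathrm{Ob}\,\mathcal C\sqcup\mathrm{Ob}\,\mathcal D$ and morphisms $$\mathrm{Hom}(x,y)=\begin{cases}\mathrm{Hom}_{\mathcal C}(x,y)& x,y\in\mathcal C,\\ \mathrm{Hom}_{\mathcal D}(x,y)& x,y\in\mathcal D,\\ \Omega(y,x)& x\in\mathcal D,\ y\in\mathcal C,\\ \emptyset& x\in\mathcal C,\ y\in\mathcal D.\end{cases}$$ Composition within $\mathcal C$ and within $\mathcal D$ is as before; for $\alpha:x_1\to x_2$ in $\mathcal D$ and $\phi\in\Omega(y,x_2)$, $\phi\alpha:=\Omega(1_y,\alpha)(\phi)$; for $\beta:y_1\to y_2$ in $\mathcal C$ and $\phi\in\Omega(y_1,x)$, $\beta\phi:=\Omega(\beta,1_x)(\phi)$.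 *)

theory Defs
  imports "HOL-Library.FuncSet"
begin

text \<open>A category is given by hom-sets, which need not be disjoint for distinct pairs of objects;
  hence identities, composition and the morphism part of functors take the objects concerned as
  arguments. \<open>Comp C x y z g f\<close> is the composite \<open>g f\<close> of \<open>f : x \<rightarrow> y\<close> and \<open>g : y \<rightarrow> z\<close>.\<close>

record ('o, 'm) cat =
  Ob :: "'o set"
  Hom :: "'o \<Rightarrow> 'o \<Rightarrow> 'm set"
  Ident :: "'o \<Rightarrow> 'm"
  Comp :: "'o \<Rightarrow> 'o \<Rightarrow> 'o \<Rightarrow> 'm \<Rightarrow> 'm \<Rightarrow> 'm"

definition category :: "('o, 'm) cat \<Rightarrow> bool" where
  "category C \<longleftrightarrow>
     (\<forall>x\<in>Ob C. Ident C x \<in> Hom C x x) \<and>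
     (\<forall>x\<in>Ob C. \<forall>y\<in>Ob C. \<forall>z\<in>Ob C. \<forall>f\<in>Hom C x y. \<forall>g\<in>Hom C y z.
        Comp C x y z g f \<in> Hom C x z) \<and>
     (\<forall>x\<in>Ob C. \<forall>y\<in>Ob C. \<forall>f\<in>Hom C x y.
        Comp C x x y f (Ident C x) = f \<and> Comp C x y y (Ident C y) f = f) \<and>
     (\<forall>w\<in>Ob C. \<forall>x\<in>Ob C. \<forall>y\<in>Ob C. \<forall>z\<in>Ob C.
        \<forall>f\<in>Hom C w x. \<forall>g\<in>Hom C x y. \<forall>h\<in>Hom C y z.
        Comp C w y z h (Comp C w x y g f) = Comp C w x z (Comp C x y z h g) f)"

definition finite_category :: "('o, 'm) cat \<Rightarrow> bool" where
  "finite_category C \<longleftrightarrow>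
     category C \<and> finite (Ob C) \<and> (\<forall>x\<in>Ob C. \<forall>y\<in>Ob C. finite (Hom C x y))"

definition full_subcategory :: "('o, 'm) cat \<Rightarrow> ('o, 'm) cat \<Rightarrow> bool" where
  "full_subcategory C E \<longleftrightarrow>
     category C \<and> category E \<and> Ob C \<subseteq> Ob E \<and>
     (\<forall>x\<in>Ob C. \<forall>y\<in>Ob C. Hom C x y = Hom E x y) \<and>
     (\<forall>x\<in>Ob C. Ident C x = Ident E x) \<and>
     (\<forall>x\<in>Ob C. \<forall>y\<in>Ob C. \<forall>z\<in>Ob C. \<forall>f\<in>Hom C x y. \<forall>g\<in>Hom C y z.
        Comp C x y z g f = Comp E x y z g f)"

definition op_cat :: "('o, 'm) cat \<Rightarrow> ('o, 'm) cat" where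
  "op_cat C = \<lparr>Ob = Ob C, Hom = (\<lambda>x y. Hom C y x), Ident = Ident C,
     Comp = (\<lambda>x y z g f. Comp C z y x f g)\<rparr>"

definition prod_cat :: "('a, 'm) cat \<Rightarrow> ('b, 'n) cat \<Rightarrow> ('a \<times> 'b, 'm \<times> 'n) cat" where
  "prod_cat C D = \<lparr>Ob = Ob C \<times> Ob D,
     Hom = (\<lambda>p q. Hom C (fst p) (fst q) \<times> Hom D (snd p) (snd q)),
     Ident = (\<lambda>p. (Ident C (fst p), Ident D (snd p))),
     Comp = (\<lambda>p q r g f. (Comp C (fst p) (fst q) (fst r) (fst g) (fst f),
                          Comp D (snd p) (snd q) (snd r) (snd g) (snd f)))\<rparr>"

text \<open>The category of finite sets with elements in \<^typ>\<open>'s\<close>. Functions are extensional, so that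
  equality of morphisms is equality of functions on their domain.\<close>

definition finset_cat :: "('s set, 's \<Rightarrow> 's) cat" where
  "finset_cat = \<lparr>Ob = {A. finite A}, Hom = (\<lambda>A B. A \<rightarrow>\<^sub>E B), Ident = (\<lambda>A. restrict (\<lambda>a. a) A),
     Comp = (\<lambda>A B C g f. compose A g f)\<rparr>"

record ('a, 'm, 'b, 'n) fctr =
  obj_map :: "'a \<Rightarrow> 'b"
  mor_map :: "'a \<Rightarrow> 'a \<Rightarrow> 'm \<Rightarrow> 'n"

definition is_functor :: "('a, 'm) cat \<Rightarrow> ('b, 'n) cat \<Rightarrow> ('a, 'm, 'b, 'n) fctr \<Rightarrow> bool" where
  "is_functor C D F \<longleftrightarrow>
     category C \<and> category D \<and>
     (\<forall>x\<in>Ob C. obj_map F x \<in> Ob D) \<and>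
     (\<forall>x\<in>Ob C. \<forall>y\<in>Ob C. \<forall>f\<in>Hom C x y. mor_map F x y f \<in> Hom D (obj_map F x) (obj_map F y)) \<and>
     (\<forall>x\<in>Ob C. mor_map F x x (Ident C x) = Ident D (obj_map F x)) \<and>
     (\<forall>x\<in>Ob C. \<forall>y\<in>Ob C. \<forall>z\<in>Ob C. \<forall>f\<in>Hom C x y. \<forall>g\<in>Hom C y z.
        mor_map F x z (Comp C x y z g f) =
        Comp D (obj_map F x) (obj_map F y) (obj_map F z) (mor_map F y z g) (mor_map F x y f))"

definition cat_iso :: "('a, 'm) cat \<Rightarrow> ('b, 'n) cat \<Rightarrow> ('a, 'm, 'b, 'n) fctr \<Rightarrow> bool" where
  "cat_iso C D F \<longleftrightarrow> is_functor C D F \<and>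
     (\<exists>K. is_functor D C K \<and>
        (\<forall>x\<in>Ob C. obj_map K (obj_map F x) = x) \<and>
        (\<forall>x\<in>Ob C. \<forall>y\<in>Ob C. \<forall>f\<in>Hom C x y.
           mor_map K (obj_map F x) (obj_map F y) (mor_map F x y f) = f) \<and>
        (\<forall>x\<in>Ob D. obj_map F (obj_map K x) = x) \<and>
        (\<forall>x\<in>Ob D. \<forall>y\<in>Ob D. \<forall>f\<in>Hom D x y.
           mor_map F (obj_map K x) (obj_map K y) (mor_map K x y f) = f))"

text \<open>\<open>E\<close> has \<open>C\<close> as a full subcategory, where \<open>F\<close> is the inclusion. Needed because in a disjoint
  union of typed objects \<open>C\<close> only sits inside \<open>E\<close> up to tagging.\<close>

definition full_subcategory_via ::
    "('a, 'm, 'b, 'n) fctr \<Rightarrow> ('a, 'm) cat \<Rightarrow> ('b, 'n) cat \<Rightarrow> bool" where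
  "full_subcategory_via F C E \<longleftrightarrow>
     is_functor C E F \<and> (\<exists>S. full_subcategory S E \<and> cat_iso C S F)"

definition inclusion :: "('a, 'm, 'a, 'm) fctr" where
  "inclusion = \<lparr>obj_map = (\<lambda>x. x), mor_map = (\<lambda>x y f. f)\<rparr>"

type_synonym ('a, 'm, 'b, 'n, 's) biset = "('a \<times> 'b, 'm \<times> 'n, 's set, 's \<Rightarrow> 's) fctr"

definition is_biset ::
    "('a, 'm) cat \<Rightarrow> ('b, 'n) cat \<Rightarrow> ('a, 'm, 'b, 'n, 's) biset \<Rightarrow> bool" where
  "is_biset C D \<Omega> \<longleftrightarrow> is_functor (prod_cat C (op_cat D)) finset_cat \<Omega>"

text \<open>\<open>\<theta>\<close> is a natural isomorphism \<open>\<Omega> \<rightarrow> \<Omega>'\<close>. The elements of the two bisets may have different types,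
  so the components are bijections rather than morphisms of one \<^const>\<open>finset_cat\<close>.\<close>

definition biset_iso ::
    "('a, 'm) cat \<Rightarrow> ('b, 'n) cat \<Rightarrow> ('a, 'm, 'b, 'n, 's) biset \<Rightarrow> ('a, 'm, 'b, 'n, 't) biset \<Rightarrow>
     ('a \<Rightarrow> 'b \<Rightarrow> 's \<Rightarrow> 't) \<Rightarrow> bool" where
  "biset_iso C D \<Omega> \<Omega>' \<theta> \<longleftrightarrow>
     is_biset C D \<Omega> \<and> is_biset C D \<Omega>' \<and>
     (\<forall>x\<in>Ob C. \<forall>y\<in>Ob D. bij_betw (\<theta> x y) (obj_map \<Omega> (x, y)) (obj_map \<Omega>' (x, y))) \<and>
     (\<forall>x\<in>Ob C. \<forall>x'\<in>Ob C. \<forall>y\<in>Ob D. \<forall>y'\<in>Ob D.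
        \<forall>\<beta>\<in>Hom C x x'. \<forall>\<alpha>\<in>Hom D y' y. \<forall>\<phi>\<in>obj_map \<Omega> (x, y).
          \<theta> x' y' (mor_map \<Omega> (x, y) (x', y') (\<beta>, \<alpha>) \<phi>) =
          mor_map \<Omega>' (x, y) (x', y') (\<beta>, \<alpha>) (\<theta> x y \<phi>))"

text \<open>The biset sending \<open>(x, y)\<close> to the set of morphisms \<open>G y \<rightarrow> F x\<close> of \<open>E\<close>; a morphism
  \<open>(\<beta>, \<alpha>) : (x, y) \<rightarrow> (x', y')\<close> of the product category consists of \<open>\<beta> : x \<rightarrow> x'\<close> in \<open>C\<close> and
  \<open>\<alpha> : y' \<rightarrow> y\<close> in \<open>D\<close>, and sends \<open>\<phi>\<close> to \<open>F \<beta> (\<phi> (G \<alpha>))\<close>.\<close>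

definition hom_biset ::
    "('a, 'm, 'e, 'k) fctr \<Rightarrow> ('e, 'k) cat \<Rightarrow> ('b, 'n, 'e, 'k) fctr \<Rightarrow> ('a, 'm, 'b, 'n, 'k) biset" where
  "hom_biset F E G =
     \<lparr>obj_map = (\<lambda>(x, y). Hom E (obj_map G y) (obj_map F x)),
      mor_map = (\<lambda>(x, y) (x', y') (\<beta>, \<alpha>).
        restrict
          (\<lambda>\<phi>. Comp E (obj_map G y') (obj_map F x) (obj_map F x')
                 (mor_map F x x' \<beta>)
                 (Comp E (obj_map G y') (obj_map G y) (obj_map F x) \<phi> (mor_map G y' y \<alpha>)))
          (Hom E (obj_map G y) (obj_map F x)))\<rparr>"

datatype ('m, 'n, 's) cog_mor = InC 'm | InD 'n | Cross 's

fun cog_hom ::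
    "('a, 'm) cat \<Rightarrow> ('b, 'n) cat \<Rightarrow> ('a, 'm, 'b, 'n, 's) biset \<Rightarrow>
     'a + 'b \<Rightarrow> 'a + 'b \<Rightarrow> ('m, 'n, 's) cog_mor set" where
  "cog_hom C D \<Omega> (Inl x) (Inl y) = InC ` Hom C x y"
| "cog_hom C D \<Omega> (Inr x) (Inr y) = InD ` Hom D x y"
| "cog_hom C D \<Omega> (Inr x) (Inl y) = Cross ` obj_map \<Omega> (y, x)"
| "cog_hom C D \<Omega> (Inl x) (Inr y) = {}"

fun cog_ident ::
    "('a, 'm) cat \<Rightarrow> ('b, 'n) cat \<Rightarrow> 'a + 'b \<Rightarrow> ('m, 'n, 's) cog_mor" where
  "cog_ident C D (Inl x) = InC (Ident C x)"
| "cog_ident C D (Inr x) = InD (Ident D x)"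

text \<open>The composites that occur; all other argument combinations are not composable.\<close>

definition cog_comp ::
    "('a, 'm) cat \<Rightarrow> ('b, 'n) cat \<Rightarrow> ('a, 'm, 'b, 'n, 's) biset \<Rightarrow>
     'a + 'b \<Rightarrow> 'a + 'b \<Rightarrow> 'a + 'b \<Rightarrow>
     ('m, 'n, 's) cog_mor \<Rightarrow> ('m, 'n, 's) cog_mor \<Rightarrow> ('m, 'n, 's) cog_mor" where
  "cog_comp C D \<Omega> x y z g f = (case (x, y, z, g, f) of
     (Inl x, Inl y, Inl z, InC g, InC f) \<Rightarrow> InC (Comp C x y z g f)
   | (Inr x, Inr y, Inr z, InD g, InD f) \<Rightarrow> InD (Comp D x y z g f)
   | (Inr x\<^sub>1, Inr x\<^sub>2, Inl y, Cross \<phi>, InD \<alpha>) \<Rightarrow>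
       Cross (mor_map \<Omega> (y, x\<^sub>2) (y, x\<^sub>1) (Ident C y, \<alpha>) \<phi>)
   | (Inr x, Inl y\<^sub>1, Inl y\<^sub>2, InC \<beta>, Cross \<phi>) \<Rightarrow>
       Cross (mor_map \<Omega> (y\<^sub>1, x) (y\<^sub>2, x) (\<beta>, Ident D x) \<phi>)
   | _ \<Rightarrow> undefined)"

definition cograph ::
    "('a, 'm) cat \<Rightarrow> ('b, 'n) cat \<Rightarrow> ('a, 'm, 'b, 'n, 's) biset \<Rightarrow>
     ('a + 'b, ('m, 'n, 's) cog_mor) cat" where
  "cograph C D \<Omega> = \<lparr>Ob = Ob C <+> Ob D, Hom = cog_hom C D \<Omega>, Ident = cog_ident C D,
     Comp = cog_comp C D \<Omega>\<rparr>"

definition cog_inclC :: "('a, 'm, 'a + 'b, ('m, 'n, 's) cog_mor) fctr" where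
  "cog_inclC = \<lparr>obj_map = Inl, mor_map = (\<lambda>x y. InC)\<rparr>"

definition cog_inclD :: "('b, 'n, 'a + 'b, ('m, 'n, 's) cog_mor) fctr" where
  "cog_inclD = \<lparr>obj_map = Inr, mor_map = (\<lambda>x y. InD)\<rparr>"

text \<open>When both categories and the biset are taken from one category, the identification of the
  cograph with that category forgets the tags of the disjoint unions.\<close>

definition cog_untag :: "('o + 'o, ('k, 'k, 'k) cog_mor, 'o, 'k) fctr" where
  "cog_untag =
     \<lparr>obj_map = case_sum (\<lambda>x. x) (\<lambda>y. y),
      mor_map = (\<lambda>x y. case_cog_mor (\<lambda>f. f) (\<lambda>f. f) (\<lambda>f. f))\<rparr>"

end

theory Submission
  imports Defs
begin

text \<open>The composition law of the cograph is associative because the two actions of a biset are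
  functorial and commute, as both are restrictions of one functor on a product category: every
  action splits as \<open>\<Omega>(\<beta>, \<alpha>) = \<Omega>(\<beta>, 1) \<Omega>(1, \<alpha>)\<close>. All isomorphisms of categories
  below are obtained from functors that are bijective on objects and on hom-sets.\<close>

section \<open>Laws of categories and functors in rule form\<close>

lemma category_ident [intro]: "category C \<Longrightarrow> x \<in> Ob C \<Longrightarrow> Ident C x \<in> Hom C x x"
  by (simp add: category_def)

lemma category_comp [intro]:
  "category C \<Longrightarrow> x \<in> Ob C \<Longrightarrow> y \<in> Ob C \<Longrightarrow> z \<in> Ob C \<Longrightarrow> f \<in> Hom C x y \<Longrightarrow> g \<in> Hom C y z
    \<Longrightarrow> Comp C x y z g f \<in> Hom C x z"
  by (simp add: category_def)

lemma category_comp_ident: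
  assumes "category C" "x \<in> Ob C" "y \<in> Ob C" "f \<in> Hom C x y"
  shows "Comp C x x y f (Ident C x) = f" "Comp C x y y (Ident C y) f = f"
  using assms by (simp_all add: category_def)

lemma category_assoc:
  "category C \<Longrightarrow> w \<in> Ob C \<Longrightarrow> x \<in> Ob C \<Longrightarrow> y \<in> Ob C \<Longrightarrow> z \<in> Ob C \<Longrightarrow>
    f \<in> Hom C w x \<Longrightarrow> g \<in> Hom C x y \<Longrightarrow> h \<in> Hom C y z \<Longrightarrow>
    Comp C w y z h (Comp C w x y g f) = Comp C w x z (Comp C x y z h g) f"
  by (simp add: category_def)

lemma category_op_cat: "category C \<Longrightarrow> category (op_cat C)"
  by (simp add: category_def op_cat_def)

lemma category_prod_cat: "category C \<Longrightarrow> category D \<Longrightarrow> category (prod_cat C D)"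
  by (auto simp: category_def prod_cat_def)

text \<open>The identity laws rest on extensionality: composing with the restricted identity forgets
  values outside the domain, and those are \<open>undefined\<close> already.\<close>

lemma category_finset_cat: "category finset_cat"
  unfolding category_def finset_cat_def
  by (auto simp: compose_def PiE_iff extensional_def restrict_def fun_eq_iff)

lemma functor_obj: "is_functor C D F \<Longrightarrow> x \<in> Ob C \<Longrightarrow> obj_map F x \<in> Ob D"
  by (simp add: is_functor_def)

lemma functor_mor:
  "is_functor C D F \<Longrightarrow> x \<in> Ob C \<Longrightarrow> y \<in> Ob C \<Longrightarrow> f \<in> Hom C x y \<Longrightarrow>
    mor_map F x y f \<in> Hom D (obj_map F x) (obj_map F y)"
  by (simp add: is_functor_def)

lemma functor_ident:
  "is_functor C D F \<Longrightarrow> x \<in> Ob C \<Longrightarrow> mor_map F x x (Ident C x) = Ident D (obj_map F x)"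
  by (simp add: is_functor_def)

lemma functor_comp:
  "is_functor C D F \<Longrightarrow> x \<in> Ob C \<Longrightarrow> y \<in> Ob C \<Longrightarrow> z \<in> Ob C \<Longrightarrow>
    f \<in> Hom C x y \<Longrightarrow> g \<in> Hom C y z \<Longrightarrow>
    mor_map F x z (Comp C x y z g f) =
    Comp D (obj_map F x) (obj_map F y) (obj_map F z) (mor_map F y z g) (mor_map F x y f)"
  by (simp add: is_functor_def)

section \<open>Isomorphisms and full embeddings from bijectivity\<close>

text \<open>The inverses on objects and hom-sets are automatically functorial: \<open>F\<close>
  sends both sides of each functor law for \<open>K\<close> to the same morphism, and
  \<open>F\<close> is injective on hom-sets.\<close>

lemma cat_isoI:
  assumes F: "is_functor C D F"
    and obj: "bij_betw (obj_map F) (Ob C) (Ob D)"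
    and mor: "\<And>x y. x \<in> Ob C \<Longrightarrow> y \<in> Ob C \<Longrightarrow>
      bij_betw (mor_map F x y) (Hom C x y) (Hom D (obj_map F x) (obj_map F y))"
  shows "cat_iso C D F"
proof -
  have cats: "category C" "category D"
    using F by (auto simp: is_functor_def)
  define k where "k = inv_into (Ob C) (obj_map F)"
  \<comment> \<open>The preimage is sought in the hom-set between \<open>k x\<close> and
    \<open>k y\<close>, since \<open>mor_map F\<close> depends on the objects and hom-sets may
    overlap.\<close>
  define K where "K = \<lparr>obj_map = k,
    mor_map = (\<lambda>x y. inv_into (Hom C (k x) (k y)) (mor_map F (k x) (k y)))\<rparr>"
  have K_sel: "obj_map K = k"
    "mor_map K x y = inv_into (Hom C (k x) (k y)) (mor_map F (k x) (k y))" for x y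
    by (simp_all add: K_def)
  have k: "k x \<in> Ob C" "obj_map F (k x) = x" if "x \<in> Ob D" for x
    using obj that unfolding k_def
    by (auto simp: bij_betw_def inv_into_into f_inv_into_f)
  have kF: "k (obj_map F x) = x" if "x \<in> Ob C" for x
    using obj that unfolding k_def by (simp add: bij_betw_def)
  have m: "mor_map K x y f \<in> Hom C (k x) (k y)" "mor_map F (k x) (k y) (mor_map K x y f) = f"
    if "x \<in> Ob D" "y \<in> Ob D" "f \<in> Hom D x y" for x y f
  proof -
    have "mor_map F (k x) (k y) ` Hom C (k x) (k y) = Hom D x y"
      using mor[of "k x" "k y"] that by (simp add: bij_betw_def k)
    with that show "mor_map K x y f \<in> Hom C (k x) (k y)"
      "mor_map F (k x) (k y) (mor_map K x y f) = f"
      by (simp_all add: K_sel inv_into_into f_inv_into_f)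
  qed
  \<comment> \<open>This carries the injectivity of \<open>F\<close>: to compute
    \<open>mor_map K\<close> at a morphism, it suffices to write that morphism as the image of a
    candidate.\<close>
  have mF: "mor_map K x y (mor_map F (k x) (k y) f) = f"
    if "x \<in> Ob D" "y \<in> Ob D" "f \<in> Hom C (k x) (k y)" for x y f
    using mor[of "k x" "k y"] that by (simp add: bij_betw_def k K_sel)
  have "is_functor D C K"
    unfolding is_functor_def K_sel(1)
  proof (intro conjI ballI)
    fix x assume "x \<in> Ob D"
    then show "mor_map K x x (Ident D x) = Ident C (k x)"
      using mF[of x x "Ident C (k x)"] F cats by (simp add: functor_ident k category_ident)
  next
    fix x y z f g
    assume o: "x \<in> Ob D" "y \<in> Ob D" "z \<in> Ob D" and f: "f \<in> Hom D x y" and g: "g \<in> Hom D y z"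
    let ?h = "Comp C (k x) (k y) (k z) (mor_map K y z g) (mor_map K x y f)"
    have "mor_map F (k x) (k z) ?h = Comp D x y z g f"
      using functor_comp[OF F, of "k x" "k y" "k z"] o f g by (simp add: k m)
    moreover have "?h \<in> Hom C (k x) (k z)"
      using cats o f g by (intro category_comp) (simp_all add: k m)
    ultimately show "mor_map K x z (Comp D x y z g f) = ?h"
      using mF[of x z ?h] o by simp
  qed (use cats in \<open>simp_all add: k m\<close>)
  \<comment> \<open>At objects of the form \<open>obj_map F x\<close>, \<open>k\<close> cancels by
    \<open>kF\<close>, which turns \<open>mF\<close> into the left inverse law on morphisms.\<close>
  then show ?thesis
    unfolding cat_iso_def using F mF[OF functor_obj[OF F] functor_obj[OF F]]
    by (intro conjI exI[of _ K]) (simp_all add: K_sel(1) k kF m)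
qed

text \<open>The category laws quantify over \<open>Ob\<close> only, so they survive shrinking it
  while all other fields stay untouched.\<close>

lemma full_subcategory_update_Ob:
  "category E \<Longrightarrow> X \<subseteq> Ob E \<Longrightarrow> full_subcategory (E\<lparr>Ob := X\<rparr>) E"
  unfolding full_subcategory_def category_def by (auto simp: subset_iff)

lemma full_subcategory_viaI:
  assumes F: "is_functor C E F"
    and obj: "inj_on (obj_map F) (Ob C)"
    and mor: "\<And>x y. x \<in> Ob C \<Longrightarrow> y \<in> Ob C \<Longrightarrow>
      bij_betw (mor_map F x y) (Hom C x y) (Hom E (obj_map F x) (obj_map F y))"
  shows "full_subcategory_via F C E"
proof -
  \<comment> \<open>The witness is \<open>E\<close> cut down to the image of \<open>F\<close>, onto
    which \<open>F\<close> is bijective on objects.\<close>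
  let ?S = "E\<lparr>Ob := obj_map F ` Ob C\<rparr>"
  have S: "full_subcategory ?S E"
    using F by (intro full_subcategory_update_Ob) (auto simp: is_functor_def)
  then have "is_functor C ?S F"
    using F by (simp add: is_functor_def full_subcategory_def)
  then have "cat_iso C ?S F"
    using obj mor by (intro cat_isoI) (simp_all add: bij_betw_def)
  with F S show ?thesis
    unfolding full_subcategory_via_def by blast
qed

lemma full_subcategory_inclusion: "full_subcategory C E \<Longrightarrow> is_functor C E inclusion"
  unfolding full_subcategory_def is_functor_def inclusion_def by (auto simp: subset_iff)

section \<open>Bisets as actions on elements\<close>

lemma biset_finite:
  "is_biset C D \<Omega> \<Longrightarrow> x \<in> Ob C \<Longrightarrow> y \<in> Ob D \<Longrightarrow> finite (obj_map \<Omega> (x, y))"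
  using functor_obj[of "prod_cat C (op_cat D)" finset_cat \<Omega> "(x, y)"]
  by (simp add: is_biset_def prod_cat_def op_cat_def finset_cat_def)

lemma biset_act:
  assumes "is_biset C D \<Omega>" "x \<in> Ob C" "x' \<in> Ob C" "y \<in> Ob D" "y' \<in> Ob D"
    "\<beta> \<in> Hom C x x'" "\<alpha> \<in> Hom D y' y" "\<phi> \<in> obj_map \<Omega> (x, y)"
  shows "mor_map \<Omega> (x, y) (x', y') (\<beta>, \<alpha>) \<phi> \<in> obj_map \<Omega> (x', y')"
  using functor_mor[of "prod_cat C (op_cat D)" finset_cat \<Omega> "(x, y)" "(x', y')" "(\<beta>, \<alpha>)"] assms
  by (auto simp: is_biset_def prod_cat_def op_cat_def finset_cat_def)

lemma biset_act_ident:
  assumes "is_biset C D \<Omega>" "x \<in> Ob C" "y \<in> Ob D" "\<phi> \<in> obj_map \<Omega> (x, y)"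
  shows "mor_map \<Omega> (x, y) (x, y) (Ident C x, Ident D y) \<phi> = \<phi>"
  using functor_ident[of "prod_cat C (op_cat D)" finset_cat \<Omega> "(x, y)"] assms
  by (simp add: is_biset_def prod_cat_def op_cat_def finset_cat_def)

text \<open>The composite in \<open>D\<close> is reversed because of \<open>op_cat\<close>. Putting
  identities for some of the morphisms yields functoriality of each one-sided action, their
  commutation, and the splitting of a two-sided action.\<close>

lemma biset_act_comp:
  assumes "is_biset C D \<Omega>" "x \<in> Ob C" "x' \<in> Ob C" "x'' \<in> Ob C" "y \<in> Ob D" "y' \<in> Ob D" "y'' \<in> Ob D"
    "\<beta> \<in> Hom C x x'" "\<beta>' \<in> Hom C x' x''" "\<alpha> \<in> Hom D y' y" "\<alpha>' \<in> Hom D y'' y'"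
    "\<phi> \<in> obj_map \<Omega> (x, y)"
  shows "mor_map \<Omega> (x', y') (x'', y'') (\<beta>', \<alpha>') (mor_map \<Omega> (x, y) (x', y') (\<beta>, \<alpha>) \<phi>) =
    mor_map \<Omega> (x, y) (x'', y'') (Comp C x x' x'' \<beta>' \<beta>, Comp D y'' y' y \<alpha> \<alpha>') \<phi>"
  using functor_comp[of "prod_cat C (op_cat D)" finset_cat \<Omega> "(x, y)" "(x', y')" "(x'', y'')"
      "(\<beta>, \<alpha>)" "(\<beta>', \<alpha>')"] assms
  by (simp add: is_biset_def prod_cat_def op_cat_def finset_cat_def compose_def)

text \<open>The functor laws come down to unit and associativity laws in \<open>E\<close>;
  \<open>fin\<close> makes the values objects of \<open>finset_cat\<close>.\<close>

lemma is_biset_hom_biset: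
  assumes C: "category C" and D: "category D"
    and F: "is_functor C E F" and G: "is_functor D E G"
    and fin: "\<And>x y. x \<in> Ob C \<Longrightarrow> y \<in> Ob D \<Longrightarrow> finite (Hom E (obj_map G y) (obj_map F x))"
  shows "is_biset C D (hom_biset F E G)"
proof -
  have E: "category E"
    using F by (simp add: is_functor_def)
  let ?T = "hom_biset F E G"
  define P where "P = prod_cat C (op_cat D)"
  have P: "category P"
    unfolding P_def by (intro category_prod_cat category_op_cat C D)
  have P_sel: "Ob P = Ob C \<times> Ob D" "Hom P (x, y) (x', y') = Hom C x x' \<times> Hom D y' y"
    "Ident P (x, y) = (Ident C x, Ident D y)"
    "Comp P (x, y) (x', y') (x'', y'') (\<beta>', \<alpha>') (\<beta>, \<alpha>) =
      (Comp C x x' x'' \<beta>' \<beta>, Comp D y'' y' y \<alpha> \<alpha>')" for x x' x'' y y' y'' \<alpha> \<alpha>' \<beta> \<beta>'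
    by (simp_all add: P_def prod_cat_def op_cat_def)
  have T_obj: "obj_map ?T (x, y) = Hom E (obj_map G y) (obj_map F x)" for x y
    by (simp add: hom_biset_def)
  note in_E = functor_obj[OF F] functor_obj[OF G] functor_mor[OF F] functor_mor[OF G]
    category_comp[OF E]
  have T_mor: "mor_map ?T (x, y) (x', y') (\<beta>, \<alpha>) \<in>
      obj_map ?T (x, y) \<rightarrow>\<^sub>E obj_map ?T (x', y')"
    if "x \<in> Ob C" "x' \<in> Ob C" "y \<in> Ob D" "y' \<in> Ob D" "\<beta> \<in> Hom C x x'" "\<alpha> \<in> Hom D y' y"
    for x x' y y' \<beta> \<alpha>
    using that by (auto simp: hom_biset_def in_E)
  have T_ident: "mor_map ?T (x, y) (x, y) (Ident C x, Ident D y) =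
      restrict (\<lambda>\<phi>. \<phi>) (obj_map ?T (x, y))"
    if "x \<in> Ob C" "y \<in> Ob D" for x y
    using that by (simp add: hom_biset_def functor_ident[OF F] functor_ident[OF G] in_E
        category_comp_ident[OF E] cong: restrict_cong)
  have T_comp: "mor_map ?T (x, y) (x'', y'') (Comp C x x' x'' \<beta>' \<beta>, Comp D y'' y' y \<alpha> \<alpha>') =
      compose (obj_map ?T (x, y)) (mor_map ?T (x', y') (x'', y'') (\<beta>', \<alpha>'))
        (mor_map ?T (x, y) (x', y') (\<beta>, \<alpha>))"
    if o: "x \<in> Ob C" "x' \<in> Ob C" "x'' \<in> Ob C" "y \<in> Ob D" "y' \<in> Ob D" "y'' \<in> Ob D"
      and m: "\<beta> \<in> Hom C x x'" "\<beta>' \<in> Hom C x' x''" "\<alpha> \<in> Hom D y' y" "\<alpha>' \<in> Hom D y'' y'"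
    for x x' x'' y y' y'' \<beta> \<beta>' \<alpha> \<alpha>'
  \<comment> \<open>Both sides are extensional on the same hom-set, so they may be compared
    elementwise.\<close>
  proof (rule extensionalityI[of _ "obj_map ?T (x, y)"])
    fix \<phi> assume "\<phi> \<in> obj_map ?T (x, y)"
    then have \<phi>: "\<phi> \<in> Hom E (obj_map G y) (obj_map F x)"
      by (simp add: T_obj)
    let ?b = "mor_map F x x' \<beta>" and ?b' = "mor_map F x' x'' \<beta>'"
      and ?a = "mor_map G y' y \<alpha>" and ?a' = "mor_map G y'' y' \<alpha>'"
    \<comment> \<open>Pure rebracketing in \<open>E\<close>: (b' b)(\<phi> (a a')) = b' ((b (\<phi>
      a)) a').\<close>
    have "Comp E (obj_map G y'') (obj_map F x) (obj_map F x'')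
        (Comp E (obj_map F x) (obj_map F x') (obj_map F x'') ?b' ?b)
        (Comp E (obj_map G y'') (obj_map G y) (obj_map F x) \<phi>
          (Comp E (obj_map G y'') (obj_map G y') (obj_map G y) ?a ?a')) =
      Comp E (obj_map G y'') (obj_map F x') (obj_map F x'') ?b'
        (Comp E (obj_map G y'') (obj_map G y') (obj_map F x')
          (Comp E (obj_map G y') (obj_map F x) (obj_map F x') ?b
            (Comp E (obj_map G y') (obj_map G y) (obj_map F x) \<phi> ?a)) ?a')"
      using o m \<phi> by (simp add: in_E category_assoc[OF E])
    with o m \<phi> show "mor_map ?T (x, y) (x'', y'') (Comp C x x' x'' \<beta>' \<beta>, Comp D y'' y' y \<alpha> \<alpha>') \<phi> =
        compose (obj_map ?T (x, y)) (mor_map ?T (x', y') (x'', y'') (\<beta>', \<alpha>'))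
          (mor_map ?T (x, y) (x', y') (\<beta>, \<alpha>)) \<phi>"
      by (simp add: compose_def hom_biset_def functor_comp[OF F] functor_comp[OF G] in_E)
  qed (use T_mor o m category_comp[OF C] category_comp[OF D] in \<open>auto simp: PiE_iff\<close>)
  have T_obj_fin: "finite (obj_map ?T (x, y))" if "x \<in> Ob C" "y \<in> Ob D" for x y
    using fin that by (simp add: T_obj)
  show ?thesis
    unfolding is_biset_def P_def[symmetric] is_functor_def
    using T_mor T_ident T_comp T_obj_fin P category_finset_cat
    by (auto simp: P_sel finset_cat_def)
qed

section \<open>The cograph and its defining biset\<close>

text \<open>A composable triple runs through objects of \<open>D\<close> and then of
  \<open>C\<close>, never back. If it stays on one side, associativity is inherited. If it crosses,
  the cases DCCC and DDDC are functoriality of the \<open>C\<close>-action and of the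
  \<open>D\<close>-action, and DDCC is their commutation.\<close>

lemma category_cograph:
  assumes C: "category C" and D: "category D" and \<Omega>: "is_biset C D \<Omega>"
  shows "category (cograph C D \<Omega>)"
proof -
  note idC = category_ident[OF C] and idD = category_ident[OF D]
  note act = biset_act[OF \<Omega>] biset_act_ident[OF \<Omega>] biset_act_comp[OF \<Omega>]
  show ?thesis
    unfolding category_def
    by (auto simp: cograph_def cog_comp_def idC idD act category_comp[OF C] category_comp[OF D]
        category_comp_ident[OF C] category_comp_ident[OF D] category_assoc[OF C] category_assoc[OF D])
qed

lemma functor_cog_inclC: "category C \<Longrightarrow> category (cograph C D \<Omega>) \<Longrightarrow>
    is_functor C (cograph C D \<Omega>) cog_inclC"
  by (auto simp: is_functor_def cog_inclC_def cograph_def cog_comp_def)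

lemma functor_cog_inclD: "category D \<Longrightarrow> category (cograph C D \<Omega>) \<Longrightarrow>
    is_functor D (cograph C D \<Omega>) cog_inclD"
  by (auto simp: is_functor_def cog_inclD_def cograph_def cog_comp_def)

lemma full_subcategory_via_cog_inclC:
  "category C \<Longrightarrow> category (cograph C D \<Omega>) \<Longrightarrow> full_subcategory_via cog_inclC C (cograph C D \<Omega>)"
  by (rule full_subcategory_viaI[OF functor_cog_inclC])
    (auto simp: cog_inclC_def cograph_def bij_betw_def inj_on_def)

lemma full_subcategory_via_cog_inclD:
  "category D \<Longrightarrow> category (cograph C D \<Omega>) \<Longrightarrow> full_subcategory_via cog_inclD D (cograph C D \<Omega>)"
  by (rule full_subcategory_viaI[OF functor_cog_inclD])
    (auto simp: cog_inclD_def cograph_def bij_betw_def inj_on_def)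

text \<open>Bijectivity holds because \<open>Cross\<close> is an injective constructor. In the
  cograph, \<beta> (\<phi> \<alpha>) is computed by acting with (1, \<alpha>) and then with
  (\<beta>, 1), so naturality is the splitting of the action of (\<beta>, \<alpha>).\<close>

lemma biset_iso_cograph:
  assumes C: "category C" and D: "category D" and \<Omega>: "is_biset C D \<Omega>"
  shows "biset_iso C D \<Omega> (hom_biset cog_inclC (cograph C D \<Omega>) cog_inclD) (\<lambda>x y. Cross)"
proof -
  note E = category_cograph[OF assms]
  have "is_biset C D (hom_biset cog_inclC (cograph C D \<Omega>) cog_inclD)"
    using biset_finite[OF \<Omega>]
    by (intro is_biset_hom_biset functor_cog_inclC functor_cog_inclD C D E)
      (simp add: cog_inclC_def cog_inclD_def cograph_def)
  then show ?thesis
    unfolding biset_iso_def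
    by (auto simp: \<Omega> hom_biset_def cog_inclC_def cog_inclD_def cograph_def cog_comp_def
        bij_betw_def inj_on_def biset_act[OF \<Omega>] biset_act_comp[OF \<Omega>]
        category_ident[OF C] category_ident[OF D]
        category_comp_ident[OF C] category_comp_ident[OF D])
qed

section \<open>Recovering a category as a cograph\<close>

text \<open>Disjointness makes untagging injective on objects. Hom-sets match by fullness within
  \<open>C\<close> and within \<open>D\<close>, by the choice of biset from \<open>D\<close> to
  \<open>C\<close>, and by \<open>empty\<close> from \<open>C\<close> to \<open>D\<close>.\<close>

lemma cat_iso_cog_untag:
  assumes E: "category E" and C: "full_subcategory C E" and D: "full_subcategory D E"
    and fin: "\<And>x y. x \<in> Ob C \<Longrightarrow> y \<in> Ob D \<Longrightarrow> finite (Hom E y x)"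
    and part: "Ob E = Ob C \<union> Ob D" "Ob C \<inter> Ob D = {}"
    and empty: "\<And>x y. x \<in> Ob C \<Longrightarrow> y \<in> Ob D \<Longrightarrow> Hom E x y = {}"
  shows "cat_iso (cograph C D (hom_biset inclusion E inclusion)) E cog_untag"
proof (rule cat_isoI)
  let ?H = "hom_biset inclusion E inclusion"
  have cats: "category C" "category D"
    using C D by (simp_all add: full_subcategory_def)
  have "is_biset C D ?H"
    using cats fin by (intro is_biset_hom_biset full_subcategory_inclusion C D)
      (simp_all add: inclusion_def)
  then have cog: "category (cograph C D ?H)"
    by (rule category_cograph[OF cats])
  note sub = C[unfolded full_subcategory_def] D[unfolded full_subcategory_def]
  have obE: "x \<in> Ob E" if "x \<in> Ob C \<or> x \<in> Ob D" for x
    using that part by blast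
  \<comment> \<open>A composite with a \<open>Cross\<close> factor is a biset action with an
    identity on one side; that identity agrees with the one of \<open>E\<close> and cancels
    there.\<close>
  show "is_functor (cograph C D ?H) E cog_untag"
    unfolding is_functor_def using cog E sub
    by (auto simp: cograph_def cog_comp_def cog_untag_def hom_biset_def inclusion_def obE
        category_ident[OF E] category_comp[OF E] category_comp_ident[OF E])
  show "bij_betw (obj_map cog_untag) (Ob (cograph C D ?H)) (Ob E)"
    using part by (auto simp: bij_betw_def inj_on_def cograph_def cog_untag_def image_Un
        Plus_def image_image)
  show "bij_betw (mor_map cog_untag x y) (Hom (cograph C D ?H) x y)
      (Hom E (obj_map cog_untag x) (obj_map cog_untag y))"
    if "x \<in> Ob (cograph C D ?H)" "y \<in> Ob (cograph C D ?H)" for x y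
    using that sub empty by (auto simp: bij_betw_def inj_on_def cograph_def cog_untag_def
        hom_biset_def inclusion_def image_image)
qed

theorem proposition4p8:
  fixes C :: "('a, 'm) cat" and D :: "('b, 'n) cat" and \<Omega> :: "('a, 'm, 'b, 'n, 's) biset"
    and C' D' E' :: "('o, 'k) cat"
  shows
    "(finite_category C \<and> finite_category D \<and> is_biset C D \<Omega> \<longrightarrow>
        (let E = cograph C D \<Omega> in
           category E \<and>
           full_subcategory_via cog_inclC C E \<and>
           full_subcategory_via cog_inclD D E \<and>
           biset_iso C D \<Omega> (hom_biset cog_inclC E cog_inclD) (\<lambda>x y. Cross)))
     \<and>
     (finite_category E' \<and> full_subcategory C' E' \<and> full_subcategory D' E' \<and>
      Ob E' = Ob C' \<union> Ob D' \<and> Ob C' \<inter> Ob D' = {} \<and>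
      (\<forall>x\<in>Ob C'. \<forall>y\<in>Ob D'. Hom E' x y = {}) \<longrightarrow>
        cat_iso (cograph C' D' (hom_biset inclusion E' inclusion)) E' cog_untag)"
proof (intro conjI impI)
  assume "finite_category C \<and> finite_category D \<and> is_biset C D \<Omega>"
  then have *: "category C" "category D" "is_biset C D \<Omega>"
    by (simp_all add: finite_category_def)
  note E = category_cograph[OF *]
  show "let E = cograph C D \<Omega> in
      category E \<and>
      full_subcategory_via cog_inclC C E \<and>
      full_subcategory_via cog_inclD D E \<and>
      biset_iso C D \<Omega> (hom_biset cog_inclC E cog_inclD) (\<lambda>x y. Cross)"
    unfolding Let_def
    by (intro conjI E full_subcategory_via_cog_inclC full_subcategory_via_cog_inclD
        biset_iso_cograph *)
next
  assume "finite_category E' \<and> full_subcategory C' E' \<and> full_subcategory D' E' \<and>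
      Ob E' = Ob C' \<union> Ob D' \<and> Ob C' \<inter> Ob D' = {} \<and>
      (\<forall>x\<in>Ob C'. \<forall>y\<in>Ob D'. Hom E' x y = {})"
  \<comment> \<open>Finiteness of the hom-sets of \<open>E'\<close> discharges
    \<open>fin\<close>.\<close>
  then show "cat_iso (cograph C' D' (hom_biset inclusion E' inclusion)) E' cog_untag"
    by (intro cat_iso_cog_untag) (auto simp: finite_category_def)
qed

end
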